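(* There exists a universal constant $c\in(\frac12,1)$ such that for every (possibly partial) function $f\colon X\to\{0,1\}$ with $X\subseteq\{0,1\}^m$, every $n\ge1$, every $\ell\in\{1,2,\dots,n\}$ and every $\gamma\in[c,1)$, \[ \mathrm{R}_{\gamma^\ell}\big(\mathrm{LD}^n_\ell\circ f\big)=\Omega\big(\ell\,\mathrm{R}(f)\big), \] where the implied constant is universal.
   Context: Query model: a deterministic decision tree queries input bits adaptively and outputs the label of the leaf reached; $\mathrm{cost}$ of a leaf is its depth. A randomized algorithm is a probability distribution over deterministic decision trees. For a relation $G$ mapping each $y\in\{0,1\}^n$ to a set $G(y)$ of allowed outputs, $G\circ f$ is the computational task on inputs $x=(x^{(1)},\dots,x^{(n)})\in X^n$ where an output $z$ is correct iff $z\in G(f(x^{(1)}),\dots,f(x^{(n)}))$. For any such task $T$ on domain $Y$, $\mathrm{R}_\gamma(T)$ is the minimum over randomized algorithms that, on every input in $Y$, produce a correct output with probability at least $\gamma$, of the maximum depth of a leaf reached over all inputs and all trees in the support. $\mathrm{R}(f)=\mathrm{R}_{2/3}(f)$ for the task of computing $f$ itself. List decoding: $\mathrm{LD}^n_\ell(y)=\{S\subseteq\{0,1\}^n: |S|=2^{n-\ell},\ y\in S\}$; i.e., the algorithm must output a list of $2^{n-\ell}$ strings containing $(f(x^{(1)}),\dots,f(x^{(n)}))$. *)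

theory Defs
  imports "HOL-Probability.Probability"
begin

datatype (queries: 'q, labels: 'o) dtree =
    Leaf 'o
  | Query 'q "('q, 'o) dtree" "('q, 'o) dtree"

primrec answer :: "('q, 'o) dtree \<Rightarrow> ('q \<Rightarrow> bool) \<Rightarrow> 'o" where
  "answer (Leaf z) x = z"
| "answer (Query q t0 t1) x = (if x q then answer t1 x else answer t0 x)"

primrec cost :: "('q, 'o) dtree \<Rightarrow> ('q \<Rightarrow> bool) \<Rightarrow> nat" where
  "cost (Leaf z) x = 0"
| "cost (Query q t0 t1) x = Suc (if x q then cost t1 x else cost t0 x)"

text \<open>
  A query task is given by the set \<open>Q\<close> of available query positions, the map \<open>bits\<close> sending
  an input to its bits, the domain \<open>Y\<close> of inputs and the set \<open>T x\<close> of correct outputs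
  on input \<open>x\<close>.
\<close>

definition solves ::
  "'q set \<Rightarrow> ('x \<Rightarrow> 'q \<Rightarrow> bool) \<Rightarrow> 'x set \<Rightarrow> ('x \<Rightarrow> 'o set) \<Rightarrow> real \<Rightarrow> ('q, 'o) dtree pmf \<Rightarrow> bool"
where
  "solves Q bits Y T \<gamma> A \<longleftrightarrow>
     (\<forall>t\<in>set_pmf A. queries t \<subseteq> Q) \<and>
     (\<forall>x\<in>Y. measure_pmf.prob A {t. answer t (bits x) \<in> T x} \<ge> \<gamma>)"

definition worst_cost ::
  "('x \<Rightarrow> 'q \<Rightarrow> bool) \<Rightarrow> 'x set \<Rightarrow> ('q, 'o) dtree pmf \<Rightarrow> enat"
where
  "worst_cost bits Y A = (SUP t\<in>set_pmf A. SUP x\<in>Y. enat (cost t (bits x)))"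

definition rand_complexity ::
  "'q set \<Rightarrow> ('x \<Rightarrow> 'q \<Rightarrow> bool) \<Rightarrow> 'x set \<Rightarrow> ('x \<Rightarrow> 'o set) \<Rightarrow> real \<Rightarrow> enat"
where
  "rand_complexity Q bits Y T \<gamma> = (INF A\<in>{A. solves Q bits Y T \<gamma> A}. worst_cost bits Y A)"

definition bit_strings :: "nat \<Rightarrow> bool list set" where
  "bit_strings m = {x. length x = m}"

text \<open>
  A partial function on \<open>m\<close>-bit strings with domain \<open>X\<close> is a total \<open>f\<close> whose values outside
  \<open>X\<close> are never used.
\<close>

definition R_fun :: "nat \<Rightarrow> bool list set \<Rightarrow> (bool list \<Rightarrow> bool) \<Rightarrow> enat" where
  "R_fun m X f = rand_complexity {..<m} (!) X (\<lambda>x. {f x}) (2/3)"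

text \<open>The \<open>j\<close>-th bit of the \<open>i\<close>-th block of an input in \<open>X\<^sup>n\<close> is the query position \<open>(i, j)\<close>.\<close>

definition R_comp ::
  "real \<Rightarrow> (bool list \<Rightarrow> 'o set) \<Rightarrow> nat \<Rightarrow> nat \<Rightarrow> bool list set \<Rightarrow> (bool list \<Rightarrow> bool) \<Rightarrow> enat"
where
  "R_comp \<gamma> G n m X f =
     rand_complexity ({..<n} \<times> {..<m}) (\<lambda>xs (i, j). xs ! i ! j)
       {xs. length xs = n \<and> set xs \<subseteq> X} (\<lambda>xs. G (map f xs)) \<gamma>"

definition LD :: "nat \<Rightarrow> nat \<Rightarrow> bool list \<Rightarrow> bool list set set" where
  "LD n l y = {S. S \<subseteq> bit_strings n \<and> card S = 2 ^ (n - l) \<and> y \<in> S}"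

end

theory Submission
  imports Defs
begin

text \<open>
  Fix a scale \<open>D\<close> and consider trees for \<open>f\<close> whose leaves carry labels \<open>(u, v)\<close> on the quarter circle
  \<open>u\<^sup>2 + v\<^sup>2 = 2\<close>; such a tree earns \<open>exp (- cost / D)\<close> times \<open>u\<close> or \<open>v\<close>, according to the value of \<open>f\<close>.
  If some distribution over trees earned more than \<open>1\<close> in expectation on every input, independent
  repetition would compute \<open>f\<close> with \<open>9 D\<close> queries. So if \<open>9 D < R(f)\<close>, the minimax principle (here by
  multiplicative weights) gives a distribution \<open>\<mu>\<close> on inputs under which no tree earns noticeably more
  than \<open>1\<close>.

  Let \<open>\<Phi>(s)\<close> be the best expected gain from the knowledge that the input lies in \<open>s\<close>. Then \<open>\<Phi>\<close>
  dominates the Euclidean norm of the two label masses of \<open>s\<close> (times \<open>sqrt 2\<close>), and a query loses at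
  most a factor \<open>exp (- 1 / D)\<close>. Both properties pass to products over \<open>n\<close> blocks, whatever the order in
  which the blocks are queried. At a leaf of a tree for \<open>n\<close> blocks the label vector has a product
  distribution, and by Cauchy-Schwarz a list of \<open>2\<^bsup>n - l\<^esup>\<close> strings captures at most
  \<open>2\<^bsup>(n - l)/2\<^esup>\<close> times its Euclidean norm. Hence \<open>q\<close> queries succeed with probability at most about
  \<open>exp (q / D) 2\<^bsup>- l/2\<^esup>\<close>, which is below \<open>\<gamma>\<^bsup>l\<^esup>\<close> unless \<open>q\<close> is of order \<open>l D\<close>.
\<close>

section \<open>Gains and losses of scoring trees\<close>

primrec graft :: "('q, 'a) dtree \<Rightarrow> ('a \<Rightarrow> ('q, 'b) dtree) \<Rightarrow> ('q, 'b) dtree" where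
  "graft (Leaf z) k = k z"
| "graft (Query q t0 t1) k = Query q (graft t0 k) (graft t1 k)"

lemma answer_graft: "answer (graft t k) y = answer (k (answer t y)) y"
  by (induction t) auto

lemma cost_graft: "cost (graft t k) y = cost t y + cost (k (answer t y)) y"
  by (induction t) auto

lemma queries_graft: "queries (graft t k) \<subseteq> queries t \<union> (\<Union>z. queries (k z))"
  by (induction t) auto

lemma answer_in_labels: "answer t y \<in> labels t"
  by (induction t) auto

definition side :: "bool \<Rightarrow> real \<times> real \<Rightarrow> real" where
  "side b p = (if b then snd p else fst p)"

text \<open>
  A leaf labelled \<open>(u, v)\<close> earns \<open>u\<close> on inputs with value \<open>False\<close> and \<open>v\<close> on inputs with value
  \<open>True\<close>. On a quarter circle of radius \<open>sqrt 2\<close> the best label for conditional masses \<open>(a, b)\<close>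
  earns \<open>sqrt 2 * sqrt (a\<^sup>2 + b\<^sup>2)\<close>, a multiple of the Euclidean norm.
\<close>

definition score_arc :: "(real \<times> real) set" where
  "score_arc = {(u, v). 0 \<le> u \<and> 0 \<le> v \<and> u\<^sup>2 + v\<^sup>2 = 2}"

lemma score_arc_side:
  assumes "p \<in> score_arc"
  shows "0 \<le> side b p" "side b p \<le> sqrt 2"
proof -
  obtain u v where p: "p = (u, v)" "0 \<le> u" "0 \<le> v" "u\<^sup>2 + v\<^sup>2 = 2"
    using assms by (auto simp: score_arc_def)
  then have "u\<^sup>2 \<le> 2" "v\<^sup>2 \<le> 2"
    using zero_le_power2[of u] zero_le_power2[of v] by linarith+
  then show "0 \<le> side b p" "side b p \<le> sqrt 2"
    using p by (auto simp: side_def intro!: real_le_rsqrt)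
qed

definition payoff :: "nat \<Rightarrow> ('q, real \<times> real) dtree \<Rightarrow> ('q \<Rightarrow> bool) \<Rightarrow> bool \<Rightarrow> real" where
  "payoff D t y b = exp (- real (cost t y) / real D) * side b (answer t y)"

lemma payoff_bounds:
  assumes "labels t \<subseteq> score_arc"
  shows "0 \<le> payoff D t y b" "payoff D t y b \<le> sqrt 2"
proof -
  have *: "answer t y \<in> score_arc"
    using assms answer_in_labels by blast
  have "exp (- real (cost t y) / real D) \<le> 1"
    by simp
  then show "0 \<le> payoff D t y b" "payoff D t y b \<le> sqrt 2"
    using score_arc_side[OF *, of b] mult_mono[of "exp (- real (cost t y) / real D)" 1 "side b (answer t y)" "sqrt 2"]
    by (auto simp: payoff_def)
qed

text \<open>
  Turns gains into losses \<open>2 - gain\<close>, where \<open>k\<close> counts the queries made so far, and cuts the tree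
  at depth \<open>D\<close>. The label \<open>2 - sqrt 2 * exp (- k / D)\<close> at a cut is below every loss that could
  still have occurred there.
\<close>

primrec penalties ::
  "nat \<Rightarrow> ('q, real \<times> real) dtree \<Rightarrow> nat \<Rightarrow> ('q, real \<times> real) dtree" where
  "penalties D (Leaf z) k =
     Leaf (2 - exp (- real k / real D) * fst z, 2 - exp (- real k / real D) * snd z)"
| "penalties D (Query q t0 t1) k =
     (if k < D then Query q (penalties D t0 (Suc k)) (penalties D t1 (Suc k))
      else Leaf (2 - sqrt 2 * exp (- real k / real D), 2 - sqrt 2 * exp (- real k / real D)))"

lemma queries_penalties: "queries (penalties D t k) \<subseteq> queries t"
proof (induction t arbitrary: k)
  case (Query q t0 t1)
  then show ?case using Query.IH[of "Suc k"] by auto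
qed auto

lemma cost_penalties: "k \<le> D \<Longrightarrow> k + cost (penalties D t k) y \<le> D"
  by (induction t arbitrary: k) (auto simp: Suc_le_eq simp flip: add_Suc)

lemma sqrt2_lt_2: "sqrt 2 < (2::real)"
  using real_sqrt_less_mono[of 2 4] by simp

text \<open>Losses are nonnegative, so they can be multiplied along a run. The second bound later
  converts a mean payoff of at least \<open>1 + \<epsilon>\<close> into a mean loss of at most
  \<open>1 - \<epsilon>\<close>.\<close>

lemma side_penalties:
  assumes "labels t \<subseteq> score_arc"
  shows "0 \<le> side b (answer (penalties D t k) y)"
    and "side b (answer (penalties D t k) y)
           \<le> 2 - exp (- real (k + cost t y) / real D) * side b (answer t y)"
proof -
  have trunc: "0 \<le> 2 - sqrt 2 * exp (- real k / real D)" for k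
    using mult_mono[of "sqrt 2" 2 "exp (- real k / real D)" 1] sqrt2_lt_2 by auto
  from assms show "0 \<le> side b (answer (penalties D t k) y)"
  proof (induction t arbitrary: k)
    case (Leaf z)
    then have "z \<in> score_arc" by simp
    from score_arc_side[OF this, of b] sqrt2_lt_2
    have "exp (- real k / real D) * side b z \<le> 1 * 2"
      by (intro mult_mono) auto
    then show ?case
      by (auto simp: side_def split: if_splits)
  next
    case (Query q t0 t1)
    then show ?case using trunc by (auto simp: side_def)
  qed
  from assms show "side b (answer (penalties D t k) y)
      \<le> 2 - exp (- real (k + cost t y) / real D) * side b (answer t y)"
  proof (induction t arbitrary: k)
    case (Leaf z)
    then show ?case by (simp add: side_def)
  next
    case (Query q t0 t1)
    show ?case
    proof (cases "k < D")
      case True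
      then show ?thesis
        using Query.IH[of "Suc k"] Query.prems by auto
    next
      case False
      let ?t = "Query q t0 t1"
      have "answer ?t y \<in> score_arc"
        using Query.prems answer_in_labels by blast
      from score_arc_side[OF this, of b]
      have "exp (- real (k + cost ?t y) / real D) * side b (answer ?t y)
          \<le> exp (- real k / real D) * sqrt 2"
        by (intro mult_mono) (auto simp: diff_divide_distrib simp del: cost.simps answer.simps)
      moreover have "side b (answer (penalties D ?t k) y) = 2 - exp (- real k / real D) * sqrt 2"
        using False by (simp add: side_def mult.commute)
      ultimately show ?thesis by linarith
    qed
  qed
qed

text \<open>The label \<open>(1, 1)\<close> is the extreme case, with equality. In terms of
  \<open>s = u + v\<close>, where \<open>u * v = s^2 / 2 - 1\<close>, the difference of the two
  sides has the factor \<open>2 - s\<close>, which is nonnegative on the arc.\<close>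

lemma discounted_arc_product:
  fixes u v a :: real
  assumes uv: "0 \<le> u" "0 \<le> v" "u\<^sup>2 + v\<^sup>2 = 2" and a: "0 \<le> a" "a \<le> 1"
  shows "(2 - a)\<^sup>2 \<le> (2 - a * u) * (2 - a * v)"
proof -
  define s where "s = u + v"
  have s2: "s\<^sup>2 = 2 + 2 * (u * v)"
    using uv by (simp add: s_def power2_sum)
  have "0 \<le> (u - v)\<^sup>2" by simp
  then have "s\<^sup>2 \<le> 2\<^sup>2"
    using uv s2 by (simp add: power2_diff)
  then have s: "s \<le> 2"
    by (rule power2_le_imp_le) simp
  have "0 \<le> s" using uv by (simp add: s_def)
  have "a * ((s + 2) / 2) \<le> 1 * 2"
    using a s \<open>0 \<le> s\<close> by (intro mult_mono) auto
  then have "0 \<le> (2 - s) * a * (2 - a * ((s + 2) / 2))"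
    using s a by simp
  also have "\<dots> = 2 * a * (2 - s) + a\<^sup>2 * (s\<^sup>2 - 4) / 2"
    by (simp add: power2_eq_square field_simps)
  also have "\<dots> = 2 * a * (2 - s) + a\<^sup>2 * (u * v - 1)"
    by (simp add: s2 field_simps)
  also have "\<dots> = (2 - a * u) * (2 - a * v) - (2 - a)\<^sup>2"
    by (simp add: s_def power2_eq_square algebra_simps)
  finally show ?thesis by simp
qed

text \<open>This makes the product of the two losses a clock for queries. The slope 2/5 meets two
  constraints: \<open>1 / (1 + \<zeta>) \<le> 1 - 2/5 * \<zeta>\<close> at an uncut leaf, where
  \<open>\<zeta> = k / D\<close> lies between 0 and 1, and
  \<open>7/5 \<le> 2 - sqrt 2 * exp (-1)\<close> at a cut, where \<open>k = D\<close>.\<close>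

lemma penalties_product:
  assumes "labels t \<subseteq> score_arc" "k \<le> D" "D > 0"
  shows "(1 + 2/5 * real (k + cost (penalties D t k) y) / real D)\<^sup>2
           \<le> fst (answer (penalties D t k) y) * snd (answer (penalties D t k) y)"
  using assms(1,2)
proof (induction t arbitrary: k)
  case (Leaf z)
  obtain u v where z: "z = (u, v)" "0 \<le> u" "0 \<le> v" "u\<^sup>2 + v\<^sup>2 = 2"
    using Leaf.prems by (auto simp: score_arc_def)
  define \<zeta> where "\<zeta> = real k / real D"
  have \<zeta>: "0 \<le> \<zeta>" "\<zeta> \<le> 1"
    using Leaf.prems \<open>D > 0\<close> by (auto simp: \<zeta>_def)
  have "exp (- \<zeta>) \<le> 1 / (1 + \<zeta>)"
    using exp_ge_add_one_self[of \<zeta>] \<zeta> by (simp add: exp_minus field_simps)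
  also have "\<dots> \<le> 1 - 2/5 * \<zeta>"
  proof -
    have "\<zeta> * (2 * \<zeta>) \<le> \<zeta> * 3"
      using \<zeta> by (intro mult_left_mono) auto
    then show ?thesis using \<zeta> by (simp add: field_simps)
  qed
  finally have "1 + 2/5 * \<zeta> \<le> 2 - exp (- \<zeta>)" by simp
  then have "(1 + 2/5 * \<zeta>)\<^sup>2 \<le> (2 - exp (- \<zeta>))\<^sup>2"
    using \<zeta> by (intro power_mono) auto
  also have "\<dots> \<le> (2 - exp (- \<zeta>) * u) * (2 - exp (- \<zeta>) * v)"
    using z \<zeta> by (intro discounted_arc_product) auto
  finally show ?case
    by (simp add: z \<zeta>_def)
next
  case (Query q t0 t1)
  show ?case
  proof (cases "k < D")
    case True
    then show ?thesis
      using Query.IH[of "Suc k"] Query.prems by simp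
  next
    case False
    then have k: "k = D" using Query.prems by simp
    have "sqrt 2 \<le> 3/2"
      by (rule real_le_lsqrt) (auto simp: power2_eq_square)
    moreover have "exp (-1) \<le> (2/5 :: real)"
      using exp_lower_Taylor_quadratic[of 1] by (simp add: exp_minus field_simps)
    ultimately have "sqrt 2 * exp (-1) \<le> 3/2 * (2/5)"
      by (intro mult_mono) auto
    then have "7/5 \<le> 2 - sqrt 2 * exp (-1)" by simp
    then have "(7/5)\<^sup>2 \<le> (2 - sqrt 2 * exp (-1))\<^sup>2"
      by (intro power_mono) auto
    then show ?thesis
      using k \<open>D > 0\<close> by (simp add: power2_eq_square)
  qed
qed

section \<open>Amplification by repetition\<close>

text \<open>
  Independent repetition: \<open>P\<close> and \<open>Q\<close> are the accumulated losses of the hypotheses \<open>False\<close> and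
  \<open>True\<close>. The loss of the true hypothesis is a supermartingale, while \<open>P * Q\<close> grows with the number
  of queries; once \<open>P * Q \<ge> 16\<close> a wrong decision means that the true hypothesis has loss at least 4.
\<close>

primrec run :: "('q, real \<times> real) dtree list \<Rightarrow> real \<Rightarrow> real \<Rightarrow> ('q, bool) dtree" where
  "run [] P Q = Leaf (P > Q)"
| "run (t # ts) P Q =
     (if P * Q \<ge> 16 then Leaf (P > Q) else graft t (\<lambda>z. run ts (P * fst z) (Q * snd z)))"

lemma queries_run:
  assumes "\<And>t. t \<in> set ts \<Longrightarrow> queries t \<subseteq> S"
  shows "queries (run ts P Q) \<subseteq> S"
  using assms
proof (induction ts arbitrary: P Q)
  case (Cons t ts)
  have "queries (graft t (\<lambda>z. run ts (P * fst z) (Q * snd z))) \<subseteq> S"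
    by (rule order_trans[OF queries_graft]) (use Cons in auto)
  then show ?case by simp
qed simp

text \<open>\<open>C\<close> counts the queries made before. Since
  \<open>(1 + a) * (1 + b) \<ge> 1 + (a + b)\<close> for nonnegative \<open>a\<close> and
  \<open>b\<close>, the lower bound on \<open>P * Q\<close> survives each round. A round starts only
  if \<open>P * Q < 16\<close>, hence with \<open>C < 15/2 * D\<close>, and adds at most
  \<open>D\<close>.\<close>

lemma cost_run:
  fixes D :: nat
  assumes "D > 0"
    and "\<And>t. t \<in> set ts \<Longrightarrow> cost t y \<le> D"
    and "\<And>t. t \<in> set ts \<Longrightarrow>
      (1 + 2/5 * real (cost t y) / real D)\<^sup>2 \<le> fst (answer t y) * snd (answer t y)"
    and "(1 + 2/5 * real C / real D)\<^sup>2 \<le> P * Q" "real C \<le> 17/2 * real D"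
  shows "real C + real (cost (run ts P Q) y) \<le> 17/2 * real D"
  using assms(2-)
proof (induction ts arbitrary: P Q C)
  case (Cons t ts)
  define c where "c = cost t y"
  show ?case
  proof (cases "P * Q \<ge> 16")
    case False
    have "(1 + 2/5 * real C / real D)\<^sup>2 < 4\<^sup>2"
      using False Cons.prems(3) by simp
    then have "1 + 2/5 * real C / real D < 4"
      by (rule power_less_imp_less_base) simp
    then have C: "real C < 15/2 * real D"
      using \<open>D > 0\<close> by (simp add: field_simps)
    have c: "c \<le> D" "(1 + 2/5 * real c / real D)\<^sup>2 \<le> fst (answer t y) * snd (answer t y)"
      using Cons.prems(1,2)[of t] by (auto simp: c_def)
    have "(1 + 2/5 * real (C + c) / real D)
        \<le> (1 + 2/5 * real C / real D) * (1 + 2/5 * real c / real D)"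
      by (simp add: algebra_simps add_divide_distrib)
    then have "(1 + 2/5 * real (C + c) / real D)\<^sup>2
        \<le> ((1 + 2/5 * real C / real D) * (1 + 2/5 * real c / real D))\<^sup>2"
      by (intro power_mono) auto
    also have "\<dots> = (1 + 2/5 * real C / real D)\<^sup>2 * (1 + 2/5 * real c / real D)\<^sup>2"
      by (rule power_mult_distrib)
    also have "\<dots> \<le> (P * Q) * (fst (answer t y) * snd (answer t y))"
      using c Cons.prems(3) by (intro mult_mono) (auto intro: order_trans[OF zero_le_power2])
    finally have *: "(1 + 2/5 * real (C + c) / real D)\<^sup>2
        \<le> (P * fst (answer t y)) * (Q * snd (answer t y))"
      by (simp add: mult_ac)
    have "real (C + c) + real (cost (run ts (P * fst (answer t y)) (Q * snd (answer t y))) y)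
        \<le> 17/2 * real D"
      using C c(1) by (intro Cons.IH Cons.prems *) auto
    then show ?thesis
      using False by (simp add: cost_graft c_def)
  qed (use Cons.prems in simp)
qed simp

lemma prob_bind_pmf:
  "measure_pmf.prob (bind_pmf p k) S = (\<integral>t. measure_pmf.prob (k t) S \<partial>p)"
  unfolding measure_pmf_bind
  by (rule measure_pmf.measure_bind[where N = "count_space UNIV"])
    (auto simp: measurable_def space_subprob_algebra intro: measure_pmf.subprob_space_axioms)

text \<open>After a wrong decision the true hypothesis carries the larger of the two losses, which
  is at least their geometric mean.\<close>

lemma wrong_side_large:
  fixes P Q r :: real
  assumes "0 \<le> P" "0 \<le> Q" "r\<^sup>2 \<le> P * Q" "(P > Q) \<noteq> b"
  shows "r \<le> side b (P, Q)"
proof (rule power2_le_imp_le)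
  have "P * Q \<le> (side b (P, Q))\<^sup>2"
    using assms by (auto simp: side_def power2_eq_square intro: mult_mono)
  then show "r\<^sup>2 \<le> (side b (P, Q))\<^sup>2" using assms by simp
qed (use assms in \<open>auto simp: side_def\<close>)

text \<open>There are two ways to err. After a stop at \<open>P * Q \<ge> 16\<close> the true loss
  must be at least 4, which accounts for 1/4 as in Markov's inequality. If the trees run out, it
  must be at least 1, while its mean has shrunk by \<open>\<delta> ^ N\<close>. Induction on the
  first tree replaces an explicit martingale argument.\<close>

lemma prob_run_wrong:
  fixes A :: "('q, real \<times> real) dtree pmf"
  assumes fin: "finite (set_pmf A)"
    and nonneg: "\<And>t b. t \<in> set_pmf A \<Longrightarrow> 0 \<le> side b (answer t y)"
    and prod: "\<And>t. t \<in> set_pmf A \<Longrightarrow> 1 \<le> fst (answer t y) * snd (answer t y)"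
    and mean: "(\<integral>t. side b (answer t y) \<partial>A) \<le> \<delta>" "\<delta> \<le> 1"
    and PQ: "0 \<le> P" "0 \<le> Q" "1 \<le> P * Q"
  shows "measure_pmf.prob (replicate_pmf N A) {ts. answer (run ts P Q) y \<noteq> b}
           \<le> side b (P, Q) * (1/4 + \<delta> ^ N)"
  using PQ
proof (induction N arbitrary: P Q)
  case 0
  then have "1 \<le> side b (P, Q)" if "(P > Q) \<noteq> b"
    using that wrong_side_large[of P Q 1 b] by simp
  moreover have "0 \<le> side b (P, Q)" using 0 by (simp add: side_def)
  ultimately show ?case by (auto simp: indicator_def)
next
  have "0 \<le> (\<integral>t. side b (answer t y) \<partial>A)"
    by (intro integral_nonneg_AE) (auto simp: AE_measure_pmf_iff nonneg)
  then have \<delta>: "0 \<le> \<delta>" using mean by simp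
  case (Suc N)
  have side0: "0 \<le> side b (P, Q)" using Suc.prems by (simp add: side_def)
  have rep: "replicate_pmf (Suc N) A = bind_pmf A (\<lambda>t. map_pmf ((#) t) (replicate_pmf N A))"
    by (simp add: map_pmf_def)
  show ?case
  proof (cases "P * Q \<ge> 16")
    case True
    have "{ts. answer (run ts P Q) y \<noteq> b} \<inter> set_pmf (replicate_pmf (Suc N) A)
        \<subseteq> {ts. (P > Q) \<noteq> b}"
      using True by (auto simp: set_replicate_pmf length_Suc_conv)
    then have "measure_pmf.prob (replicate_pmf (Suc N) A) {ts. answer (run ts P Q) y \<noteq> b}
        \<le> measure_pmf.prob (replicate_pmf (Suc N) A) {ts. (P > Q) \<noteq> b}"
      by (subst measure_Int_set_pmf[symmetric]) (intro measure_pmf.finite_measure_mono, auto)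
    also have "\<dots> \<le> side b (P, Q) * (1/4)"
    proof (cases "(P > Q) \<noteq> b")
      case True
      then have "4 \<le> side b (P, Q)"
        using wrong_side_large[of P Q 4 b] Suc.prems \<open>P * Q \<ge> 16\<close> by simp
      then show ?thesis
        using measure_pmf.prob_le_1[of "replicate_pmf (Suc N) A" "{ts. (P > Q) \<noteq> b}"] by simp
    qed (use side0 in simp)
    also have "\<dots> \<le> side b (P, Q) * (1/4 + \<delta> ^ Suc N)"
      using side0 \<delta> by (intro mult_left_mono) auto
    finally show ?thesis .
  next
    case False
    have "measure_pmf.prob (replicate_pmf (Suc N) A) {ts. answer (run ts P Q) y \<noteq> b}
        = (\<integral>t. measure_pmf.prob (replicate_pmf N A)
              {ts. answer (run ts (P * fst (answer t y)) (Q * snd (answer t y))) y \<noteq> b} \<partial>A)"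
      unfolding rep prob_bind_pmf using False
      by (simp add: vimage_def answer_graft)
    also have "\<dots> \<le> (\<integral>t. side b (P, Q) * (1/4 + \<delta> ^ N) * side b (answer t y) \<partial>A)"
    proof (rule integral_mono_AE)
      have "measure_pmf.prob (replicate_pmf N A)
              {ts. answer (run ts (P * fst (answer t y)) (Q * snd (answer t y))) y \<noteq> b}
            \<le> side b (P, Q) * (1/4 + \<delta> ^ N) * side b (answer t y)" if t: "t \<in> set_pmf A" for t
      proof -
        have z: "0 \<le> fst (answer t y)" "0 \<le> snd (answer t y)"
          using nonneg[OF t, of False] nonneg[OF t, of True] by (auto simp: side_def)
        have "1 * 1 \<le> (P * Q) * (fst (answer t y) * snd (answer t y))"
          using prod[OF t] Suc.prems by (intro mult_mono) auto
        then have "1 \<le> (P * fst (answer t y)) * (Q * snd (answer t y))"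
          by (simp add: mult_ac)
        from Suc.IH[OF _ _ this] z Suc.prems show ?thesis
          by (simp add: side_def mult_ac split: if_splits)
      qed
      then show "AE t in A. measure_pmf.prob (replicate_pmf N A)
              {ts. answer (run ts (P * fst (answer t y)) (Q * snd (answer t y))) y \<noteq> b}
            \<le> side b (P, Q) * (1/4 + \<delta> ^ N) * side b (answer t y)"
        by (simp add: AE_measure_pmf_iff)
    qed (intro integrable_measure_pmf_finite fin)+
    also have "\<dots> = side b (P, Q) * (1/4 + \<delta> ^ N) * (\<integral>t. side b (answer t y) \<partial>A)"
      by simp
    also have "\<dots> \<le> side b (P, Q) * (1/4 + \<delta> ^ N) * \<delta>"
      using side0 \<delta> mean by (intro mult_left_mono) auto
    also have "\<dots> = side b (P, Q) * (\<delta> * (1/4) + \<delta> ^ Suc N)"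
      by (simp add: algebra_simps)
    also have "\<dots> \<le> side b (P, Q) * (1/4 + \<delta> ^ Suc N)"
      using side0 mean(2) by (intro mult_left_mono) auto
    finally show ?thesis .
  qed
qed

text \<open>The number \<open>N\<close> of repetitions depends on \<open>\<epsilon>\<close>, but the
  query bound does not, because \<open>run\<close> stops once the product of the losses is large. So
  an arbitrarily small advantage suffices.\<close>

lemma rand_complexity_le_if_payoff:
  fixes A :: "('q, real \<times> real) dtree pmf" and bits :: "'x \<Rightarrow> 'q \<Rightarrow> bool"
  assumes fin: "finite (set_pmf A)" and D: "D > 0" and \<epsilon>: "\<epsilon> > 0"
    and A: "\<And>t. t \<in> set_pmf A \<Longrightarrow> queries t \<subseteq> S" "\<And>t. t \<in> set_pmf A \<Longrightarrow> labels t \<subseteq> score_arc"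
    and pay: "\<And>x. x \<in> X \<Longrightarrow> 1 + \<epsilon> \<le> (\<integral>t. payoff D t (bits x) (f x) \<partial>A)"
  shows "rand_complexity S bits X (\<lambda>x. {f x}) (2/3) \<le> enat (9 * D)"
proof -
  define A' where "A' = map_pmf (\<lambda>t. penalties D t 0) A"
  define \<delta> where "\<delta> = max 0 (1 - \<epsilon>)"
  have \<delta>: "0 \<le> \<delta>" "\<delta> < 1" using \<epsilon> by (auto simp: \<delta>_def)
  \<comment> \<open>The sum \<open>1/4 + 1/12\<close> is the permitted error 1/3.\<close>
  obtain N where N: "\<delta> ^ N < 1/12"
    using real_arch_pow_inv[of "1/12" \<delta>] \<delta> by auto
  define B where "B = map_pmf (\<lambda>ts. run ts 1 1) (replicate_pmf N A')"
  have fin': "finite (set_pmf A')" using fin by (simp add: A'_def)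
  have A'D: "\<exists>u\<in>set_pmf A. t = penalties D u 0" if "t \<in> set_pmf A'" for t
    using that by (auto simp: A'_def)
  have nonneg: "0 \<le> side b (answer t y)" if "t \<in> set_pmf A'" for t b y
    using A'D[OF that] A(2) side_penalties(1) by blast
  have cost: "cost t y \<le> D" if "t \<in> set_pmf A'" for t y
    using A'D[OF that] cost_penalties[of 0 D _ y] by auto
  have prod: "(1 + 2/5 * real (cost t y) / real D)\<^sup>2 \<le> fst (answer t y) * snd (answer t y)"
    if t: "t \<in> set_pmf A'" for t y
  proof -
    obtain u where u: "u \<in> set_pmf A" "t = penalties D u 0" using A'D[OF t] by blast
    show ?thesis
      using penalties_product[OF A(2)[OF u(1)] le0 D, of y] by (simp add: u(2))
  qed
  have prod1: "1 \<le> fst (answer t y) * snd (answer t y)" if "t \<in> set_pmf A'" for t y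
  proof -
    have "1\<^sup>2 \<le> (1 + 2/5 * real (cost t y) / real D)\<^sup>2"
      by (intro power_mono) auto
    also note prod[OF that]
    finally show ?thesis by simp
  qed
  have mean: "(\<integral>t. side (f x) (answer t (bits x)) \<partial>A') \<le> \<delta>" if "x \<in> X" for x
  proof -
    have "(\<integral>t. side (f x) (answer t (bits x)) \<partial>A')
        = (\<integral>t. side (f x) (answer (penalties D t 0) (bits x)) \<partial>A)"
      by (simp add: A'_def)
    also have "\<dots> \<le> (\<integral>t. 2 - payoff D t (bits x) (f x) \<partial>A)"
    proof (rule integral_mono_AE)
      have "side (f x) (answer (penalties D t 0) (bits x)) \<le> 2 - payoff D t (bits x) (f x)"
        if "t \<in> set_pmf A" for t
        using side_penalties(2)[OF A(2)[OF that], of "f x" D 0 "bits x"] by (simp add: payoff_def)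
      then show "AE t in A. side (f x) (answer (penalties D t 0) (bits x)) \<le> 2 - payoff D t (bits x) (f x)"
        by (simp add: AE_measure_pmf_iff)
    qed (intro integrable_measure_pmf_finite fin)+
    also have "\<dots> = 2 - (\<integral>t. payoff D t (bits x) (f x) \<partial>A)"
      by (subst Bochner_Integration.integral_diff)
        (simp_all add: integrable_measure_pmf_finite fin)
    also have "\<dots> \<le> \<delta>" using pay[OF that] by (simp add: \<delta>_def)
    finally show ?thesis .
  qed
  have "solves S bits X (\<lambda>x. {f x}) (2/3) B"
    unfolding solves_def
  proof (intro conjI ballI)
    fix t assume "t \<in> set_pmf B"
    then obtain ts where ts: "t = run ts 1 1" "set ts \<subseteq> set_pmf A'"
      by (auto simp: B_def set_replicate_pmf)
    show "queries t \<subseteq> S"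
      unfolding ts(1)
    proof (rule queries_run)
      fix t' assume "t' \<in> set ts"
      then obtain u where u: "u \<in> set_pmf A" "t' = penalties D u 0"
        using ts(2) A'D by blast
      show "queries t' \<subseteq> S"
        unfolding u(2) by (rule order_trans[OF queries_penalties A(1)[OF u(1)]])
    qed
  next
    fix x assume x: "x \<in> X"
    have "measure_pmf.prob B {t. answer t (bits x) \<noteq> f x} \<le> side (f x) (1, 1) * (1/4 + \<delta> ^ N)"
      unfolding B_def measure_map_pmf vimage_def mem_Collect_eq
      using fin' nonneg prod1 mean[OF x] \<delta> by (intro prob_run_wrong) auto
    also have "\<dots> \<le> 1/3" using N by (simp add: side_def)
    finally have "measure_pmf.prob B (- {t. answer t (bits x) \<in> {f x}}) \<le> 1/3"
      by (simp add: Collect_neg_eq[symmetric])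
    moreover have "measure_pmf.prob B (- {t. answer t (bits x) \<in> {f x}})
        = 1 - measure_pmf.prob B {t. answer t (bits x) \<in> {f x}}"
      using measure_pmf.prob_compl[of "{t. answer t (bits x) \<in> {f x}}" B]
      by (simp add: Compl_eq_Diff_UNIV)
    ultimately show "measure_pmf.prob B {t. answer t (bits x) \<in> {f x}} \<ge> 2/3"
      by simp
  qed
  then have "rand_complexity S bits X (\<lambda>x. {f x}) (2/3) \<le> worst_cost bits X B"
    unfolding rand_complexity_def by (intro INF_lower) simp
  also have "\<dots> \<le> enat (9 * D)"
    unfolding worst_cost_def
  proof (intro SUP_least)
    fix t x assume "t \<in> set_pmf B"
    then obtain ts where ts: "t = run ts 1 1" "set ts \<subseteq> set_pmf A'"
      by (auto simp: B_def set_replicate_pmf)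
    have "real 0 + real (cost (run ts 1 1) (bits x)) \<le> 17/2 * real D"
      using ts(2) cost prod D by (intro cost_run) auto
    then show "enat (cost t (bits x)) \<le> enat (9 * D)"
      using ts(1) by simp
  qed
  finally show ?thesis .
qed

section \<open>Minimax and hard distributions\<close>

text \<open>Combine \<open>exp (- y) \<le> 1 / (1 + y)\<close> with
  \<open>(1 + y) * (1 - y + y^2) = 1 + y^3\<close>.\<close>

lemma exp_minus_le_quadratic:
  fixes y :: real
  assumes "0 \<le> y"
  shows "exp (- y) \<le> 1 - y + y\<^sup>2"
proof -
  have "1 \<le> (1 + y) * (1 - y + y\<^sup>2)"
    using assms by (simp add: algebra_simps power2_eq_square)
  then have "1 / (1 + y) \<le> 1 - y + y\<^sup>2"
    using assms by (simp add: field_simps)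
  moreover have "exp (- y) \<le> 1 / (1 + y)"
    using exp_ge_add_one_self[of y] assms by (simp add: exp_minus field_simps)
  ultimately show ?thesis by simp
qed

text \<open>Each input is weighted by \<open>exp\<close> of \<open>- \<eta>\<close> times its payoff
  so far, and the next tree is one earning at least \<open>v\<close> against the normalised weights.
  It shrinks the total weight by at least the factor \<open>1 - \<eta> * v + 4 * \<eta>^2\<close>,
  whose last term bounds \<open>(\<eta> * p t x)^2\<close> for payoffs up to 2.\<close>

lemma multiplicative_weights:
  fixes p :: "'t \<Rightarrow> 'x \<Rightarrow> real"
  assumes X: "finite X" "X \<noteq> {}"
    and best: "\<And>\<mu>. (\<And>x. 0 \<le> \<mu> x) \<Longrightarrow> sum \<mu> X = 1 \<Longrightarrow> \<exists>t\<in>T. v \<le> (\<Sum>x\<in>X. \<mu> x * p t x)"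
    and p: "\<And>t x. t \<in> T \<Longrightarrow> x \<in> X \<Longrightarrow> 0 \<le> p t x \<and> p t x \<le> 2"
    and \<eta>: "0 < \<eta>"
  shows "\<exists>ts. length ts = K \<and> set ts \<subseteq> T \<and>
    (\<Sum>x\<in>X. exp (- \<eta> * (\<Sum>t\<leftarrow>ts. p t x))) \<le> real (card X) * exp (- real K * (\<eta> * v - 4 * \<eta>\<^sup>2))"
proof (induction K)
  case (Suc K)
  then obtain ts where ts: "length ts = K" "set ts \<subseteq> T"
    and le: "(\<Sum>x\<in>X. exp (- \<eta> * (\<Sum>t\<leftarrow>ts. p t x)))
      \<le> real (card X) * exp (- real K * (\<eta> * v - 4 * \<eta>\<^sup>2))"
    by blast
  define w where "w x = exp (- \<eta> * (\<Sum>t\<leftarrow>ts. p t x))" for x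
  define W where "W = sum w X"
  have W: "0 < W"
    unfolding W_def using X by (intro sum_pos) (auto simp: w_def)
  obtain t where t: "t \<in> T" "v \<le> (\<Sum>x\<in>X. w x / W * p t x)"
    using best[of "\<lambda>x. w x / W"] W by (auto simp: w_def W_def simp flip: sum_divide_distrib)
  have "v * W \<le> (\<Sum>x\<in>X. w x / W * p t x) * W"
    using t W by (intro mult_right_mono) auto
  also have "\<dots> = (\<Sum>x\<in>X. w x * p t x)"
    using W by (simp add: sum_distrib_right)
  finally have v: "v * W \<le> (\<Sum>x\<in>X. w x * p t x)" .
  have "(\<Sum>x\<in>X. exp (- \<eta> * (\<Sum>t\<leftarrow>t # ts. p t x))) = (\<Sum>x\<in>X. w x * exp (- (\<eta> * p t x)))"
    by (simp add: w_def algebra_simps flip: exp_add)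
  also have "\<dots> \<le> (\<Sum>x\<in>X. w x * (1 - \<eta> * p t x + 4 * \<eta>\<^sup>2))"
  proof (intro sum_mono mult_left_mono)
    fix x assume x: "x \<in> X"
    have "exp (- (\<eta> * p t x)) \<le> 1 - \<eta> * p t x + (\<eta> * p t x)\<^sup>2"
      using p[OF t(1) x] \<eta> by (intro exp_minus_le_quadratic) auto
    also have "(\<eta> * p t x)\<^sup>2 \<le> (\<eta> * 2)\<^sup>2"
      using p[OF t(1) x] \<eta> by (intro power_mono mult_left_mono) auto
    finally show "exp (- (\<eta> * p t x)) \<le> 1 - \<eta> * p t x + 4 * \<eta>\<^sup>2"
      by (simp add: power_mult_distrib)
  qed (simp add: w_def)
  also have "\<dots> = W * (1 + 4 * \<eta>\<^sup>2) - \<eta> * (\<Sum>x\<in>X. w x * p t x)"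
    by (simp add: W_def algebra_simps sum.distrib sum_subtractf sum_distrib_left sum_distrib_right)
  also have "\<dots> \<le> W * (1 + 4 * \<eta>\<^sup>2) - \<eta> * (v * W)"
    using v \<eta> by simp
  also have "\<dots> = W * (1 + - (\<eta> * v - 4 * \<eta>\<^sup>2))"
    by (simp add: algebra_simps)
  also have "\<dots> \<le> W * exp (- (\<eta> * v - 4 * \<eta>\<^sup>2))"
    using W by (intro mult_left_mono exp_ge_add_one_self) auto
  also have "\<dots> \<le> (real (card X) * exp (- real K * (\<eta> * v - 4 * \<eta>\<^sup>2))) * exp (- (\<eta> * v - 4 * \<eta>\<^sup>2))"
    using le by (intro mult_right_mono) (auto simp: W_def w_def)
  also have "\<dots> = real (card X) * exp (- real (Suc K) * (\<eta> * v - 4 * \<eta>\<^sup>2))"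
    by (simp add: algebra_simps flip: exp_add)
  finally show ?case
    using ts t by (intro exI[of _ "t # ts"]) auto
qed auto

lemma approximate_minimax:
  fixes p :: "'t \<Rightarrow> 'x \<Rightarrow> real"
  assumes X: "finite X" "X \<noteq> {}"
    and best: "\<And>\<mu>. (\<And>x. 0 \<le> \<mu> x) \<Longrightarrow> sum \<mu> X = 1 \<Longrightarrow> \<exists>t\<in>T. v \<le> (\<Sum>x\<in>X. \<mu> x * p t x)"
    and p: "\<And>t x. t \<in> T \<Longrightarrow> x \<in> X \<Longrightarrow> 0 \<le> p t x \<and> p t x \<le> 2"
    and \<delta>: "0 < \<delta>"
  shows "\<exists>A. finite (set_pmf A) \<and> set_pmf A \<subseteq> T \<and> (\<forall>x\<in>X. v - \<delta> \<le> (\<integral>t. p t x \<partial>measure_pmf A))"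
proof -
  \<comment> \<open>With this rate \<open>4 * \<eta>^2 = \<eta> * \<delta> / 2\<close>: half of the
    slack pays for the quadratic error, the other half for \<open>ln (card X)\<close> once
    \<open>K\<close> is large.\<close>
  define \<eta> where "\<eta> = \<delta> / 8"
  have \<eta>: "0 < \<eta>" using \<delta> by (simp add: \<eta>_def)
  obtain K0 :: nat where K0: "ln (real (card X)) / (\<eta> * (\<delta> / 2)) < real K0"
    using reals_Archimedean2 by blast
  define K where "K = Suc K0"
  have "ln (real (card X)) / (\<eta> * (\<delta> / 2)) < real K"
    using K0 by (simp add: K_def)
  then have K: "ln (real (card X)) \<le> real K * (\<eta> * (\<delta> / 2))" "K > 0"
    using \<eta> \<delta> by (auto simp: pos_divide_less_eq K_def mult_ac)
  obtain ts where ts: "length ts = K" "set ts \<subseteq> T"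
    and le: "(\<Sum>x\<in>X. exp (- \<eta> * (\<Sum>t\<leftarrow>ts. p t x)))
      \<le> real (card X) * exp (- real K * (\<eta> * v - 4 * \<eta>\<^sup>2))"
    using multiplicative_weights[OF X best p \<eta>, of K] by blast
  define A where "A = map_pmf ((!) ts) (pmf_of_set {..<K})"
  have ne: "{..<K} \<noteq> {}" using K by auto
  have "v - \<delta> \<le> (\<integral>t. p t x \<partial>measure_pmf A)" if x: "x \<in> X" for x
  proof -
    have card: "real (card X) > 0" using X by (simp add: card_gt_0_iff)
    \<comment> \<open>The weight of one input is at most the total weight, so the bound on the total
      controls every input separately.\<close>
    have "exp (- \<eta> * (\<Sum>t\<leftarrow>ts. p t x)) \<le> (\<Sum>x\<in>X. exp (- \<eta> * (\<Sum>t\<leftarrow>ts. p t x)))"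
      using x X by (intro member_le_sum) auto
    also note le
    also have "real (card X) * exp (- real K * (\<eta> * v - 4 * \<eta>\<^sup>2))
        = exp (ln (real (card X)) - real K * (\<eta> * v - 4 * \<eta>\<^sup>2))"
      using card unfolding diff_conv_add_uminus[of "ln _"] exp_add by simp
    finally have "- \<eta> * (\<Sum>t\<leftarrow>ts. p t x) \<le> ln (real (card X)) - real K * (\<eta> * v - 4 * \<eta>\<^sup>2)"
      by simp
    also have "\<dots> \<le> real K * (\<eta> * (\<delta> / 2)) - real K * (\<eta> * v - 4 * \<eta>\<^sup>2)"
      using K by simp
    also have "\<dots> = - \<eta> * (real K * (v - \<delta>))"
      by (simp add: \<eta>_def field_simps power2_eq_square)
    finally have "real K * (v - \<delta>) \<le> (\<Sum>t\<leftarrow>ts. p t x)"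
      using \<eta> by simp
    then have "v - \<delta> \<le> (\<Sum>t\<leftarrow>ts. p t x) / real K"
      using K by (simp add: field_simps)
    also have "(\<Sum>t\<leftarrow>ts. p t x) = (\<Sum>i<K. p (ts ! i) x)"
      by (simp add: sum_list_sum_nth ts(1) atLeast0LessThan)
    also have "\<dots> / real K = (\<integral>t. p t x \<partial>measure_pmf A)"
      unfolding A_def integral_map_pmf using ne by (subst integral_pmf_of_set) auto
    finally show ?thesis .
  qed
  moreover have "set_pmf A = set ts"
    using ne ts(1) by (auto simp: A_def in_set_conv_nth)
  ultimately show ?thesis using ts(2) by (intro exI[of _ A]) auto
qed

text \<open>The value \<open>v\<close> cannot be below 1 here, since the leaf labelled
  \<open>(1, 1)\<close> earns 1 without a query. Values \<open>1 + \<epsilon>\<close> are therefore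
  nearly optimal.\<close>

definition hard_distribution ::
  "'q set \<Rightarrow> ('x \<Rightarrow> 'q \<Rightarrow> bool) \<Rightarrow> 'x set \<Rightarrow> ('x \<Rightarrow> bool) \<Rightarrow> nat \<Rightarrow> real \<Rightarrow> ('x \<Rightarrow> real) \<Rightarrow> bool" where
  "hard_distribution S bits X f D v \<mu> \<longleftrightarrow>
     (\<forall>x. 0 \<le> \<mu> x) \<and> sum \<mu> X = 1 \<and>
     (\<forall>t. queries t \<subseteq> S \<longrightarrow> labels t \<subseteq> score_arc \<longrightarrow>
        (\<Sum>x\<in>X. \<mu> x * payoff D t (bits x) (f x)) \<le> v)"

lemma hard_distribution_exists:
  assumes X: "finite X" and D: "D > 0" and \<epsilon>: "\<epsilon> > 0"
    and R: "enat (9 * D) < rand_complexity S bits X (\<lambda>x. {f x}) (2/3)"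
  shows "\<exists>\<mu>. hard_distribution S bits X f D (1 + \<epsilon>) \<mu>"
proof (rule ccontr)
  assume no: "\<not> ?thesis"
  define T where "T = {t. queries t \<subseteq> S \<and> labels t \<subseteq> score_arc}"
  have "\<exists>A. finite (set_pmf A) \<and> set_pmf A \<subseteq> T \<and>
      (\<forall>x\<in>X. (1 + \<epsilon>) - \<epsilon> / 2 \<le> (\<integral>t. payoff D t (bits x) (f x) \<partial>measure_pmf A))"
  \<comment> \<open>The minimax lemma needs a nonempty set of inputs; for an empty one the claim is
    vacuous.\<close>
  proof (cases "X = {}")
    case True
    then show ?thesis
      by (intro exI[of _ "return_pmf (Leaf (1, 1))"]) (auto simp: T_def score_arc_def)
  next
    case False
    show ?thesis
    proof (rule approximate_minimax[OF X False])
      fix \<mu> :: "'a \<Rightarrow> real"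
      assume \<mu>: "\<And>x. 0 \<le> \<mu> x" "sum \<mu> X = 1"
      have "\<not> hard_distribution S bits X f D (1 + \<epsilon>) \<mu>"
        using no by blast
      then obtain t where "t \<in> T" "\<not> (\<Sum>x\<in>X. \<mu> x * payoff D t (bits x) (f x)) \<le> 1 + \<epsilon>"
        unfolding hard_distribution_def T_def using \<mu> by blast
      then show "\<exists>t\<in>T. 1 + \<epsilon> \<le> (\<Sum>x\<in>X. \<mu> x * payoff D t (bits x) (f x))"
        by (intro bexI[of _ t]) auto
    next
      fix t x assume "t \<in> T"
      then show "0 \<le> payoff D t (bits x) (f x) \<and> payoff D t (bits x) (f x) \<le> 2"
        using payoff_bounds[of t D "bits x" "f x"] sqrt2_lt_2 by (auto simp: T_def)
    qed (use \<epsilon> in simp)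
  qed
  then obtain A where A: "finite (set_pmf A)" "set_pmf A \<subseteq> T"
    "\<And>x. x \<in> X \<Longrightarrow> (1 + \<epsilon>) - \<epsilon> / 2 \<le> (\<integral>t. payoff D t (bits x) (f x) \<partial>measure_pmf A)"
    by blast
  have "1 + \<epsilon> / 2 \<le> (\<integral>t. payoff D t (bits x) (f x) \<partial>measure_pmf A)" if "x \<in> X" for x
    using A(3)[OF that] by simp
  then have "rand_complexity S bits X (\<lambda>x. {f x}) (2/3) \<le> enat (9 * D)"
    using A(2) \<epsilon> by (intro rand_complexity_le_if_payoff[OF A(1) D, of "\<epsilon> / 2"]) (auto simp: T_def)
  with R show False by simp
qed

section \<open>Adaptive trees on many blocks\<close>

text \<open>The inputs reaching a given node of a tree on \<open>n\<close> blocks form such a box,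
  as each query restricts a single block.\<close>

definition list_box :: "nat \<Rightarrow> (nat \<Rightarrow> 'x set) \<Rightarrow> 'x list set" where
  "list_box n s = {xs. length xs = n \<and> (\<forall>i<n. xs ! i \<in> s i)}"

lemma bij_betw_list_box_PiE:
  "bij_betw (\<lambda>xs. restrict ((!) xs) {..<n}) (list_box n s) (PiE {..<n} s)"
proof (rule bij_betw_byWitness[where f' = "\<lambda>g. map g [0..<n]"])
  show "\<forall>xs\<in>list_box n s. map (restrict ((!) xs) {..<n}) [0..<n] = xs"
    by (auto simp: list_box_def intro!: nth_equalityI)
  show "\<forall>g\<in>PiE {..<n} s. restrict ((!) (map g [0..<n])) {..<n} = g"
    by (auto simp: PiE_def extensional_def restrict_def fun_eq_iff)
qed (auto simp: list_box_def PiE_def Pi_def)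

lemma finite_list_box:
  assumes "\<And>i. i < n \<Longrightarrow> finite (s i)"
  shows "finite (list_box n s)"
  using bij_betw_finite[OF bij_betw_list_box_PiE[of n s]] assms finite_PiE[of "{..<n}" s] by simp

lemma sum_list_box:
  fixes h :: "nat \<Rightarrow> 'x \<Rightarrow> real"
  assumes "\<And>i. i < n \<Longrightarrow> finite (s i)"
  shows "(\<Sum>xs\<in>list_box n s. \<Prod>i<n. h i (xs ! i)) = (\<Prod>i<n. \<Sum>x\<in>s i. h i x)"
proof -
  have "(\<Sum>xs\<in>list_box n s. \<Prod>i<n. h i (xs ! i))
      = (\<Sum>xs\<in>list_box n s. \<Prod>i<n. h i (restrict ((!) xs) {..<n} i))"
    by (intro sum.cong prod.cong) auto
  also have "\<dots> = (\<Sum>g\<in>PiE {..<n} s. \<Prod>i<n. h i (g i))"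
    by (rule sum.reindex_bij_betw[OF bij_betw_list_box_PiE])
  also have "\<dots> = (\<Prod>i<n. \<Sum>x\<in>s i. h i x)"
    using assms by (intro prod_sum_PiE[symmetric]) auto
  finally show ?thesis .
qed

definition mass :: "('x \<Rightarrow> bool) \<Rightarrow> ('x \<Rightarrow> real) \<Rightarrow> 'x set \<Rightarrow> bool \<Rightarrow> real" where
  "mass f \<mu> s b = sum \<mu> {x \<in> s. f x = b}"

text \<open>Grouping inputs by label vector leaves a sum over \<open>z\<close> of products of
  masses. Cauchy-Schwarz costs \<open>sqrt (card z)\<close>, and the sum of squares, enlarged to all
  strings, factors over the blocks.\<close>

lemma list_mass_le:
  assumes fin: "\<And>i. i < n \<Longrightarrow> finite (s i)"
    and z: "z \<subseteq> bit_strings n" "card z = 2 ^ (n - l)"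
  shows "(\<Sum>xs\<in>list_box n s. (\<Prod>i<n. \<mu> (xs ! i)) * of_bool (map f xs \<in> z))
    \<le> sqrt 2 ^ (n - l) * (\<Prod>i<n. sqrt ((mass f \<mu> (s i) False)\<^sup>2 + (mass f \<mu> (s i) True)\<^sup>2))"
proof -
  define M where "M i b = mass f \<mu> (s i) b" for i b
  have sqrt_prod: "sqrt (\<Prod>i<k. g i) = (\<Prod>i<k. sqrt (g i))" for g :: "nat \<Rightarrow> real" and k
    by (induction k) (simp_all add: real_sqrt_mult)
  have strings: "bit_strings n = list_box n (\<lambda>_. UNIV)"
    by (auto simp: bit_strings_def list_box_def)
  have fin_z: "finite z"
    using z(1) finite_list_box[of n "\<lambda>_. UNIV :: bool set"] by (auto simp: strings dest: finite_subset)
  \<comment> \<open>A label vector constrains each block separately, so its fiber is again a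
    box.\<close>
  have fiber: "{xs \<in> {xs \<in> list_box n s. map f xs \<in> z}. map f xs = y} = list_box n (\<lambda>i. {x \<in> s i. f x = y ! i})"
    if y: "y \<in> z" for y
  proof -
    have "length y = n" using y z(1) by (auto simp: bit_strings_def)
    then have "map f xs = y \<longleftrightarrow> (\<forall>i<n. f (xs ! i) = y ! i)" if "length xs = n" for xs
      using that by (simp add: list_eq_iff_nth_eq)
    then show ?thesis
      using y by (auto simp: list_box_def)
  qed
  have "(\<Sum>xs\<in>list_box n s. (\<Prod>i<n. \<mu> (xs ! i)) * of_bool (map f xs \<in> z))
      = (\<Sum>xs | xs \<in> list_box n s \<and> map f xs \<in> z. \<Prod>i<n. \<mu> (xs ! i))"
    using finite_list_box[of n s] fin by (intro sum.mono_neutral_cong_right) auto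
  also have "\<dots> = (\<Sum>y\<in>z. \<Sum>xs\<in>{xs \<in> {xs \<in> list_box n s. map f xs \<in> z}. map f xs = y}. \<Prod>i<n. \<mu> (xs ! i))"
    using finite_list_box[of n s] fin fin_z by (intro sum.group[symmetric]) auto
  also have "\<dots> = (\<Sum>y\<in>z. \<Prod>i<n. M i (y ! i))"
  proof (rule sum.cong[OF refl])
    fix y assume "y \<in> z"
    then show "(\<Sum>xs\<in>{xs \<in> {xs \<in> list_box n s. map f xs \<in> z}. map f xs = y}. \<Prod>i<n. \<mu> (xs ! i))
        = (\<Prod>i<n. M i (y ! i))"
      unfolding fiber[OF \<open>y \<in> z\<close>] M_def mass_def
      using fin by (intro sum_list_box[where h = "\<lambda>_. \<mu>"]) auto
  qed
  finally have eq: "(\<Sum>xs\<in>list_box n s. (\<Prod>i<n. \<mu> (xs ! i)) * of_bool (map f xs \<in> z))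
      = (\<Sum>y\<in>z. \<Prod>i<n. M i (y ! i))" .
  have "(\<Sum>y\<in>z. \<Prod>i<n. M i (y ! i))\<^sup>2 \<le> real (card z) * (\<Sum>y\<in>z. (\<Prod>i<n. M i (y ! i))\<^sup>2)"
    using sum_squared_le_sum_of_squares[of "\<lambda>y. \<Prod>i<n. M i (y ! i)" z] by (simp add: mult.commute)
  also have "(\<Sum>y\<in>z. (\<Prod>i<n. M i (y ! i))\<^sup>2) \<le> (\<Sum>y\<in>bit_strings n. (\<Prod>i<n. M i (y ! i))\<^sup>2)"
    using z(1) finite_list_box[of n "\<lambda>_. UNIV :: bool set"] by (intro sum_mono2) (auto simp: strings)
  also have "\<dots> = (\<Sum>y\<in>list_box n (\<lambda>_. UNIV). \<Prod>i<n. (M i (y ! i))\<^sup>2)"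
    by (simp add: strings prod_power_distrib)
  also have "\<dots> = (\<Prod>i<n. \<Sum>b\<in>UNIV. (M i b)\<^sup>2)"
    by (rule sum_list_box) simp
  finally have "(\<Sum>y\<in>z. \<Prod>i<n. M i (y ! i))\<^sup>2 \<le> 2 ^ (n - l) * (\<Prod>i<n. (M i False)\<^sup>2 + (M i True)\<^sup>2)"
    by (simp add: z(2) UNIV_bool)
  then have "(\<Sum>y\<in>z. \<Prod>i<n. M i (y ! i)) \<le> sqrt (2 ^ (n - l) * (\<Prod>i<n. (M i False)\<^sup>2 + (M i True)\<^sup>2))"
    by (rule real_le_rsqrt)
  also have "\<dots> = sqrt 2 ^ (n - l) * (\<Prod>i<n. sqrt ((M i False)\<^sup>2 + (M i True)\<^sup>2))"
    by (simp add: real_sqrt_mult real_sqrt_power sqrt_prod)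
  finally show ?thesis by (simp add: eq M_def)
qed

section \<open>Access to several blocks, and the potential of one block\<close>

definition block_bits :: "('x \<Rightarrow> 'q \<Rightarrow> bool) \<Rightarrow> 'x list \<Rightarrow> nat \<times> 'q \<Rightarrow> bool" where
  "block_bits bits xs = (\<lambda>(i, j). bits (xs ! i) j)"

context
  fixes S :: "'q set" and bits :: "'x \<Rightarrow> 'q \<Rightarrow> bool" and f :: "'x \<Rightarrow> bool"
    and D :: nat and \<mu> :: "'x \<Rightarrow> real"
  assumes \<mu>: "\<And>x. 0 \<le> \<mu> x"
begin

text \<open>The weights are not normalised on \<open>s\<close>, so a query splits this quantity into
  a plain sum over its two answers.\<close>

definition mean_payoff :: "('q, real \<times> real) dtree \<Rightarrow> 'x set \<Rightarrow> real" where
  "mean_payoff t s = (\<Sum>x\<in>s. \<mu> x * payoff D t (bits x) (f x))"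

definition scoring :: "('q, real \<times> real) dtree set" where
  "scoring = {t. queries t \<subseteq> S \<and> labels t \<subseteq> score_arc}"

definition potential :: "'x set \<Rightarrow> real" where
  "potential s = (SUP t\<in>scoring. mean_payoff t s)"

lemma mean_payoff_nonneg: "t \<in> scoring \<Longrightarrow> 0 \<le> mean_payoff t s"
  unfolding mean_payoff_def by (intro sum_nonneg mult_nonneg_nonneg) (auto simp: \<mu> scoring_def payoff_bounds)

lemma Leaf_scoring: "Leaf (1, 1) \<in> scoring"
  by (simp add: scoring_def score_arc_def)

lemma mean_payoff_le_potential:
  assumes "t \<in> scoring"
  shows "mean_payoff t s \<le> potential s"
  unfolding potential_def
proof (intro cSUP_upper assms bdd_aboveI2)
  fix t assume "t \<in> scoring"
  then show "mean_payoff t s \<le> (\<Sum>x\<in>s. \<mu> x * sqrt 2)"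
    unfolding mean_payoff_def
    by (intro sum_mono mult_left_mono) (auto simp: \<mu> scoring_def payoff_bounds)
qed

lemma potential_le: "(\<And>t. t \<in> scoring \<Longrightarrow> mean_payoff t s \<le> v) \<Longrightarrow> potential s \<le> v"
  unfolding potential_def using Leaf_scoring by (intro cSUP_least) auto

lemma potential_nonneg: "0 \<le> potential s"
  using mean_payoff_nonneg mean_payoff_le_potential Leaf_scoring order_trans by blast

lemma mean_payoff_Leaf:
  assumes "finite s"
  shows "mean_payoff (Leaf (u, v)) s = mass f \<mu> s False * u + mass f \<mu> s True * v"
proof -
  have "mean_payoff (Leaf (u, v)) s = (\<Sum>x\<in>s. if f x then \<mu> x * v else \<mu> x * u)"
    unfolding mean_payoff_def by (intro sum.cong) (auto simp: payoff_def side_def)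
  also have "\<dots> = (\<Sum>x\<in>s \<inter> {x. f x}. \<mu> x * v) + (\<Sum>x\<in>s \<inter> - {x. f x}. \<mu> x * u)"
    using assms by (rule sum.If_cases)
  also have "s \<inter> {x. f x} = {x \<in> s. f x = True}" by auto
  also have "s \<inter> - {x. f x} = {x \<in> s. f x = False}" by auto
  finally show ?thesis
    by (simp add: mass_def sum_distrib_right)
qed

text \<open>The best label points in the direction of the mass vector, the equality case of
  Cauchy-Schwarz. A zero mass vector has no direction and is treated separately.\<close>

lemma potential_ge_norm:
  assumes "finite s"
  shows "sqrt 2 * sqrt ((mass f \<mu> s False)\<^sup>2 + (mass f \<mu> s True)\<^sup>2) \<le> potential s"
proof -
  let ?a = "mass f \<mu> s False" and ?b = "mass f \<mu> s True"
  define h where "h = sqrt (?a\<^sup>2 + ?b\<^sup>2)"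
  have nonneg: "0 \<le> ?a" "0 \<le> ?b" "0 \<le> h"
    unfolding mass_def h_def by (auto intro!: sum_nonneg simp: \<mu>)
  have h2: "h\<^sup>2 = ?a\<^sup>2 + ?b\<^sup>2" by (simp add: h_def)
  show ?thesis
  proof (cases "h = 0")
    case True
    then show ?thesis using potential_nonneg[of s] by (simp add: h_def)
  next
    case False
    define u where "u = sqrt 2 * ?a / h"
    define v where "v = sqrt 2 * ?b / h"
    have "u\<^sup>2 + v\<^sup>2 = 2 * (?a\<^sup>2 + ?b\<^sup>2) / h\<^sup>2"
      by (simp add: u_def v_def power_divide power_mult_distrib add_divide_distrib distrib_left)
    then have "u\<^sup>2 + v\<^sup>2 = 2"
      using False by (simp flip: h2)
    then have "Leaf (u, v) \<in> scoring"
      using nonneg by (simp add: scoring_def score_arc_def u_def v_def)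
    then have "mean_payoff (Leaf (u, v)) s \<le> potential s"
      by (rule mean_payoff_le_potential)
    moreover have "mean_payoff (Leaf (u, v)) s = sqrt 2 * (?a\<^sup>2 + ?b\<^sup>2) / h"
      unfolding mean_payoff_Leaf[OF assms]
      by (simp add: u_def v_def power2_eq_square distrib_left add_divide_distrib mult_ac)
    moreover have "\<dots> = sqrt 2 * h"
      using False unfolding h2[symmetric] by (simp add: power2_eq_square)
    ultimately show ?thesis by (simp add: h_def)
  qed
qed

lemma mean_payoff_Query:
  assumes "finite s"
  shows "mean_payoff (Query q t0 t1) s = exp (- 1 / real D) *
    (mean_payoff t0 {x \<in> s. \<not> bits x q} + mean_payoff t1 {x \<in> s. bits x q})"
proof -
  have step: "exp (- real (Suc c) / real D) = exp (- 1 / real D) * exp (- real c / real D)" for c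
    by (simp add: diff_divide_distrib flip: exp_add)
  have "mean_payoff (Query q t0 t1) s = (\<Sum>x\<in>s. if bits x q
      then exp (- 1 / real D) * (\<mu> x * payoff D t1 (bits x) (f x))
      else exp (- 1 / real D) * (\<mu> x * payoff D t0 (bits x) (f x)))"
    unfolding mean_payoff_def payoff_def cost.simps step by (intro sum.cong) auto
  also have "\<dots> = (\<Sum>x\<in>s \<inter> {x. bits x q}. exp (- 1 / real D) * (\<mu> x * payoff D t1 (bits x) (f x)))
      + (\<Sum>x\<in>s \<inter> - {x. bits x q}. exp (- 1 / real D) * (\<mu> x * payoff D t0 (bits x) (f x)))"
    using assms by (rule sum.If_cases)
  also have "s \<inter> {x. bits x q} = {x \<in> s. bits x q}" by auto
  also have "s \<inter> - {x. bits x q} = {x \<in> s. \<not> bits x q}" by auto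
  finally show ?thesis
    by (simp add: mean_payoff_def sum_distrib_left distrib_left)
qed

text \<open>The two subtrees below a query can be optimised independently, one supremum after the
  other; the factor is the discount for the query itself.\<close>

lemma potential_ge_query:
  assumes s: "finite s" and q: "q \<in> S"
  shows "exp (- 1 / real D) *
    (potential {x \<in> s. \<not> bits x q} + potential {x \<in> s. bits x q}) \<le> potential s"
proof -
  let ?e = "exp (- 1 / real D)" and ?s0 = "{x \<in> s. \<not> bits x q}" and ?s1 = "{x \<in> s. bits x q}"
  have *: "mean_payoff t0 ?s0 + mean_payoff t1 ?s1 \<le> potential s / ?e"
    if "t0 \<in> scoring" "t1 \<in> scoring" for t0 t1
  proof -
    have "Query q t0 t1 \<in> scoring"
      using that q by (auto simp: scoring_def)
    from mean_payoff_le_potential[OF this, of s] show ?thesis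
      by (simp add: mean_payoff_Query[OF s] pos_le_divide_eq mult.commute)
  qed
  have "mean_payoff t0 ?s0 \<le> potential s / ?e - potential ?s1" if t0: "t0 \<in> scoring" for t0
  proof -
    have "potential ?s1 \<le> potential s / ?e - mean_payoff t0 ?s0"
      using *[OF t0] by (intro potential_le) (simp add: algebra_simps)
    then show ?thesis by simp
  qed
  then have "potential ?s0 \<le> potential s / ?e - potential ?s1"
    by (rule potential_le)
  then have "potential ?s0 + potential ?s1 \<le> potential s / ?e"
    by linarith
  then show ?thesis
    by (simp add: pos_le_divide_eq mult.commute)
qed

text \<open>Induction over the tree for arbitrary boxes. A query changes the potential of one block
  only, the others being common factors, so the one-block inequality absorbs the discount whatever
  the order in which blocks are visited.\<close>

lemma discounted_success_le:
  assumes "queries T \<subseteq> {..<n} \<times> S" "\<And>i. i < n \<Longrightarrow> finite (s i)" "l \<le> n"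
  shows "(\<Sum>xs\<in>list_box n s. (\<Prod>i<n. \<mu> (xs ! i)) * (exp (- real (cost T (block_bits bits xs)) / real D) *
      of_bool (answer T (block_bits bits xs) \<in> LD n l (map f xs))))
    \<le> (1 / sqrt 2) ^ l * (\<Prod>i<n. potential (s i))"
  using assms
proof (induction T arbitrary: s)
  case (Leaf z)
  have pot: "0 \<le> (1 / sqrt 2) ^ l * (\<Prod>i<n. potential (s i))"
    by (intro mult_nonneg_nonneg prod_nonneg) (auto simp: potential_nonneg)
  show ?case
  proof (cases "z \<subseteq> bit_strings n \<and> card z = 2 ^ (n - l)")
    case False
    then have "(z \<in> LD n l y) = False" for y by (auto simp: LD_def)
    then show ?thesis using pot by simp
  next
    case True
    define h where "h i = sqrt ((mass f \<mu> (s i) False)\<^sup>2 + (mass f \<mu> (s i) True)\<^sup>2)" for i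
    have h: "0 \<le> h i" for i by (simp add: h_def)
    have "(z \<in> LD n l y) = (y \<in> z)" for y using True by (simp add: LD_def)
    then have "(\<Sum>xs\<in>list_box n s. (\<Prod>i<n. \<mu> (xs ! i)) * of_bool (z \<in> LD n l (map f xs)))
        \<le> sqrt 2 ^ (n - l) * (\<Prod>i<n. h i)"
      using list_mass_le[of n s z l \<mu> f] True Leaf.prems by (simp add: h_def)
    \<comment> \<open>Each block receives the factor \<open>sqrt 2\<close> that its potential can
      absorb; the \<open>l\<close> missing factors become the gain.\<close>
    also have "\<dots> = (1 / sqrt 2) ^ l * (\<Prod>i<n. sqrt 2 * h i)"
      using \<open>l \<le> n\<close> by (simp add: prod.distrib power_diff power_divide)
    also have "\<dots> \<le> (1 / sqrt 2) ^ l * (\<Prod>i<n. potential (s i))"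
      using potential_ge_norm Leaf.prems h
      by (intro mult_left_mono prod_mono) (auto simp: h_def)
    finally show ?thesis by simp
  qed
next
  case (Query q t0 t1)
  obtain i j where q: "q = (i, j)" by force
  have ij: "i < n" "j \<in> S" using Query.prems(1) by (auto simp: q)
  define s0 where "s0 = s(i := {x \<in> s i. \<not> bits x j})"
  define s1 where "s1 = s(i := {x \<in> s i. bits x j})"
  define W where "W T xs = (\<Prod>i<n. \<mu> (xs ! i)) *
    (exp (- real (cost T (block_bits bits xs)) / real D) *
      of_bool (answer T (block_bits bits xs) \<in> LD n l (map f xs)))" for T xs
  have fin: "finite (s0 k)" "finite (s1 k)" if "k < n" for k
    using Query.prems(2)[OF that] by (auto simp: s0_def s1_def)
  have split: "list_box n s = list_box n s0 \<union> list_box n s1" "list_box n s0 \<inter> list_box n s1 = {}"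
    using ij by (auto simp: list_box_def s0_def s1_def)
  have b0: "\<not> block_bits bits xs q" if "xs \<in> list_box n s0" for xs
    using that ij by (auto simp: list_box_def s0_def block_bits_def q)
  have b1: "block_bits bits xs q" if "xs \<in> list_box n s1" for xs
    using that ij by (auto simp: list_box_def s1_def block_bits_def q)
  have step: "exp (- real (Suc c) / real D) = exp (- 1 / real D) * exp (- real c / real D)" for c
    by (simp add: diff_divide_distrib flip: exp_add)
  have "(\<Sum>xs\<in>list_box n s. W (Query q t0 t1) xs)
      = (\<Sum>xs\<in>list_box n s0. W (Query q t0 t1) xs) + (\<Sum>xs\<in>list_box n s1. W (Query q t0 t1) xs)"
    unfolding split(1) using split(2) fin by (intro sum.union_disjoint finite_list_box) auto
  also have "(\<Sum>xs\<in>list_box n s0. W (Query q t0 t1) xs) = exp (- 1 / real D) * (\<Sum>xs\<in>list_box n s0. W t0 xs)"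
    unfolding sum_distrib_left W_def cost.simps answer.simps step using b0
    by (intro sum.cong) auto
  also have "(\<Sum>xs\<in>list_box n s1. W (Query q t0 t1) xs) = exp (- 1 / real D) * (\<Sum>xs\<in>list_box n s1. W t1 xs)"
    unfolding sum_distrib_left W_def cost.simps answer.simps step using b1
    by (intro sum.cong) auto
  also have "exp (- 1 / real D) * (\<Sum>xs\<in>list_box n s0. W t0 xs) + exp (- 1 / real D) * (\<Sum>xs\<in>list_box n s1. W t1 xs)
      \<le> exp (- 1 / real D) * ((1 / sqrt 2) ^ l * (\<Prod>i<n. potential (s0 i)))
        + exp (- 1 / real D) * ((1 / sqrt 2) ^ l * (\<Prod>i<n. potential (s1 i)))"
    unfolding W_def using Query.prems fin by (intro add_mono mult_left_mono Query.IH) auto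
  also have "(\<Prod>i<n. potential (s0 i)) = potential (s0 i) * (\<Prod>k\<in>{..<n} - {i}. potential (s k))"
    using ij by (subst prod.remove[of _ i]) (auto simp: s0_def intro!: prod.cong)
  also have "(\<Prod>i<n. potential (s1 i)) = potential (s1 i) * (\<Prod>k\<in>{..<n} - {i}. potential (s k))"
    using ij by (subst prod.remove[of _ i]) (auto simp: s1_def intro!: prod.cong)
  also have "exp (- 1 / real D) * ((1 / sqrt 2) ^ l * (potential (s0 i) * (\<Prod>k\<in>{..<n} - {i}. potential (s k))))
        + exp (- 1 / real D) * ((1 / sqrt 2) ^ l * (potential (s1 i) * (\<Prod>k\<in>{..<n} - {i}. potential (s k))))
      = ((1 / sqrt 2) ^ l * (\<Prod>k\<in>{..<n} - {i}. potential (s k)))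
        * (exp (- 1 / real D) * (potential (s0 i) + potential (s1 i)))"
    by (simp only: distrib_left distrib_right mult_ac)
  also have "\<dots> \<le> ((1 / sqrt 2) ^ l * (\<Prod>k\<in>{..<n} - {i}. potential (s k))) * potential (s i)"
    using potential_ge_query[of "s i" j] Query.prems(2) ij
    by (intro mult_left_mono mult_nonneg_nonneg prod_nonneg)
      (auto simp: s0_def s1_def potential_nonneg)
  also have "\<dots> = (1 / sqrt 2) ^ l * (\<Prod>i<n. potential (s i))"
    using ij by (subst (2) prod.remove[of _ i]) auto
  finally show ?case by (simp only: W_def)
qed

end

text \<open>Draw the blocks independently from \<open>\<mu>\<close>. With at most \<open>q\<close>
  queries, success is at most \<open>exp (q / D)\<close> times discounted success, and averaging
  over inputs and trees bounds \<open>g\<close>.\<close>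

lemma solves_LD_bound:
  fixes bits :: "'x \<Rightarrow> 'q \<Rightarrow> bool" and D :: nat
  assumes hard: "hard_distribution S bits X f D v \<mu>" and X: "finite X" and l: "l \<le> n"
    and A: "solves ({..<n} \<times> S) (block_bits bits) {xs. length xs = n \<and> set xs \<subseteq> X}
      (\<lambda>xs. LD n l (map f xs)) g A"
    and cost: "\<And>t xs. t \<in> set_pmf A \<Longrightarrow> length xs = n \<Longrightarrow> set xs \<subseteq> X \<Longrightarrow>
      cost t (block_bits bits xs) \<le> q"
  shows "g \<le> exp (real q / real D) * ((1 / sqrt 2) ^ l * v ^ n)"
proof -
  have \<mu>: "\<And>x. 0 \<le> \<mu> x" "sum \<mu> X = 1"
    and pay: "\<And>t. queries t \<subseteq> S \<Longrightarrow> labels t \<subseteq> score_arc \<Longrightarrow>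
      (\<Sum>x\<in>X. \<mu> x * payoff D t (bits x) (f x)) \<le> v"
    using hard by (auto simp: hard_distribution_def)
  let ?\<Phi> = "potential S bits f D \<mu> X"
  have \<Phi>: "0 \<le> ?\<Phi>" "?\<Phi> \<le> v"
    using potential_nonneg[of \<mu>, OF \<mu>(1)]
      potential_le[of \<mu>, OF \<mu>(1), where s = X and v = v and S = S and D = D and bits = bits and f = f] pay
    by (auto simp: scoring_def[of \<mu>, OF \<mu>(1)] mean_payoff_def[of \<mu>, OF \<mu>(1)])
  define Y where "Y = list_box n (\<lambda>_. X)"
  have Y: "Y = {xs. length xs = n \<and> set xs \<subseteq> X}"
    by (auto simp: Y_def list_box_def in_set_conv_nth subset_iff)
  have finY: "finite Y" unfolding Y_def by (rule finite_list_box) (rule X)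
  define w where "w xs = (\<Prod>i<n. \<mu> (xs ! i))" for xs
  have w0: "0 \<le> w xs" for xs unfolding w_def by (intro prod_nonneg) (auto simp: \<mu>)
  have w1: "sum w Y = 1"
    unfolding w_def Y_def using sum_list_box[of n "\<lambda>_. X" "\<lambda>_. \<mu>"] X \<mu>(2) by simp
  define G where "G xs = {t. answer t (block_bits bits xs) \<in> LD n l (map f xs)}" for xs
  define B where "B = exp (real q / real D) * ((1 / sqrt 2) ^ l * v ^ n)"
  have tree: "(\<Sum>xs\<in>Y. w xs * indicator (G xs) t) \<le> B" if t: "t \<in> set_pmf A" for t
  proof -
    have "(\<Sum>xs\<in>Y. w xs * indicator (G xs) t)
        \<le> (\<Sum>xs\<in>Y. exp (real q / real D) * (w xs * (exp (- real (cost t (block_bits bits xs)) / real D) *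
            of_bool (answer t (block_bits bits xs) \<in> LD n l (map f xs)))))"
    proof (rule sum_mono)
      fix xs assume "xs \<in> Y"
      then have "cost t (block_bits bits xs) \<le> q" using cost t by (auto simp: Y)
      then have "real (cost t (block_bits bits xs)) / real D \<le> real q / real D"
        by (intro divide_right_mono) auto
      then have "1 \<le> exp (real q / real D) * exp (- real (cost t (block_bits bits xs)) / real D)"
        by (simp flip: exp_add)
      from mult_left_mono[OF this w0, of xs]
      show "w xs * indicator (G xs) t \<le> exp (real q / real D) * (w xs *
          (exp (- real (cost t (block_bits bits xs)) / real D) *
            of_bool (answer t (block_bits bits xs) \<in> LD n l (map f xs))))"
        by (auto simp: G_def indicator_def mult_ac)
    qed
    also have "\<dots> \<le> exp (real q / real D) * ((1 / sqrt 2) ^ l * (\<Prod>i<n. ?\<Phi>))"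
      unfolding sum_distrib_left[symmetric] w_def Y_def
      using A t X l by (intro mult_left_mono discounted_success_le[OF \<mu>(1)]) (auto simp: solves_def)
    also have "\<dots> \<le> B"
      unfolding B_def using \<Phi> by (intro mult_left_mono) (auto intro: power_mono)
    finally show ?thesis .
  qed
  have "g = (\<Sum>xs\<in>Y. w xs * g)" using w1 by (simp flip: sum_distrib_right)
  also have "\<dots> \<le> (\<Sum>xs\<in>Y. w xs * measure_pmf.prob A (G xs))"
    using A w0 by (intro sum_mono mult_left_mono) (auto simp: solves_def G_def Y)
  also have "\<dots> = (\<integral>t. (\<Sum>xs\<in>Y. w xs * indicator (G xs) t) \<partial>A)"
    by (subst Bochner_Integration.integral_sum)
      (auto intro!: integrable_mult_right measure_pmf.integrable_const_bound[where B = 1])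
  also have "\<dots> \<le> (\<integral>t. B \<partial>A)"
    using tree
    by (intro integral_mono_AE Bochner_Integration.integrable_sum integrable_mult_right)
      (auto simp: AE_measure_pmf_iff intro!: measure_pmf.integrable_const_bound[where B = 1])
  also have "\<dots> = B" by simp
  finally show ?thesis by (simp add: B_def)
qed

section \<open>The lower bound\<close>

text \<open>Used in the contrapositive: nonzero complexity provides inputs with both values of
  \<open>f\<close>.\<close>

lemma rand_complexity_constant:
  fixes S :: "'q set" and f :: "'x \<Rightarrow> 'o"
  assumes "\<And>x. x \<in> X \<Longrightarrow> f x = b"
  shows "rand_complexity S bits X (\<lambda>x. {f x}) (2/3) = 0"
proof -
  have "solves S bits X (\<lambda>x. {f x}) (2/3) (return_pmf (Leaf b))"
    using assms by (auto simp: solves_def indicator_def)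
  then have "rand_complexity S bits X (\<lambda>x. {f x}) (2/3)
      \<le> worst_cost bits X (return_pmf (Leaf b :: ('q, 'o) dtree))"
    unfolding rand_complexity_def by (intro INF_lower) simp
  also have "\<dots> \<le> 0"
    unfolding worst_cost_def by (intro SUP_least) (simp add: zero_enat_def)
  finally show ?thesis by simp
qed

text \<open>This covers nonzero complexities up to 9, out of reach of the minimax argument. On one
  input of each value, a leaf earns \<open>(u + v) / 2 \<le> 1\<close>, and a query at scale 1
  discounts by \<open>exp (- 1) \<le> 1/2\<close>, more than a label of size \<open>sqrt 2\<close>
  can recover.\<close>

lemma hard_distribution_nonconstant:
  assumes X: "finite X" "x0 \<in> X" "x1 \<in> X" and f: "\<not> f x0" "f x1"
  shows "hard_distribution S bits X f 1 1 (\<lambda>x. of_bool (x = x0 \<or> x = x1) / 2)"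
proof -
  have ne: "x0 \<noteq> x1" using f by auto
  have pair: "(\<Sum>x\<in>X. of_bool (x = x0 \<or> x = x1) / 2 * h x) = (h x0 + h x1) / 2" for h :: "'a \<Rightarrow> real"
  proof -
    have "(\<Sum>x\<in>X. of_bool (x = x0 \<or> x = x1) / 2 * h x) = (\<Sum>x\<in>{x0, x1}. h x / 2)"
      using X by (intro sum.mono_neutral_cong_right) auto
    then show ?thesis using ne by (simp add: add_divide_distrib)
  qed
  have "payoff 1 t (bits x0) (f x0) + payoff 1 t (bits x1) (f x1) \<le> 2"
    if lab: "labels t \<subseteq> score_arc" for t :: "('b, real \<times> real) dtree"
  proof (cases t)
    case (Leaf z)
    then obtain u v where z: "z = (u, v)" "u\<^sup>2 + v\<^sup>2 = 2"
      using lab by (auto simp: score_arc_def)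
    have "0 \<le> (u - 1)\<^sup>2 + (v - 1)\<^sup>2" by simp
    then have "u + v \<le> 2" using z(2) by (simp add: power2_diff)
    then show ?thesis using f by (simp add: Leaf z(1) payoff_def side_def)
  next
    case (Query q t0 t1)
    have "payoff 1 t y b \<le> 1" for y b
    proof -
      have "answer t y \<in> score_arc" using lab answer_in_labels by blast
      from score_arc_side[OF this, of b] sqrt2_lt_2
      have side: "0 \<le> side b (answer t y)" "side b (answer t y) \<le> 2" by auto
      have "1 \<le> real (cost t y)" by (simp add: Query)
      then have "exp (- real (cost t y) / real 1) \<le> exp (- 1)" by simp
      also have "\<dots> \<le> 1 / 2"
        using exp_ge_add_one_self[of 1] by (simp add: exp_minus field_simps)
      finally have "payoff 1 t y b \<le> 1 / 2 * 2"
        unfolding payoff_def using side by (intro mult_mono) auto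
      then show ?thesis by simp
    qed
    from add_mono[OF this this] show ?thesis by simp
  qed
  moreover have "(\<Sum>x\<in>X. of_bool (x = x0 \<or> x = x1) / 2) = (1 :: real)"
    using pair[of "\<lambda>_. 1"] by (simp del: of_bool_or_iff)
  ultimately show ?thesis
    unfolding hard_distribution_def pair by (simp del: of_bool_or_iff)
qed

lemma solves_LD_cost:
  fixes bits :: "'x \<Rightarrow> 'q \<Rightarrow> bool" and D :: nat
  assumes X: "finite X" and l: "l \<le> n" and D: "D > 0" and \<gamma>: "9/10 \<le> \<gamma>"
    and hard: "\<And>\<epsilon>. \<epsilon> > 0 \<Longrightarrow> \<exists>\<mu>. hard_distribution S bits X f D (1 + \<epsilon>) \<mu>"
    and A: "solves ({..<n} \<times> S) (block_bits bits) {xs. length xs = n \<and> set xs \<subseteq> X}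
      (\<lambda>xs. LD n l (map f xs)) (\<gamma> ^ l) A"
    and cost: "\<And>t xs. t \<in> set_pmf A \<Longrightarrow> length xs = n \<Longrightarrow> set xs \<subseteq> X \<Longrightarrow>
      cost t (block_bits bits xs) \<le> q"
  shows "real D * real l / 6 \<le> real q"
proof -
  \<comment> \<open>The constants fit together through
    \<open>exp (1/6) \<le> 6/5 = 9/10 * (4/3) \<le> \<gamma> * sqrt 2\<close>.\<close>
  have "5/6 \<le> exp (- (1/6 :: real))"
    using exp_ge_add_one_self[of "- (1/6)"] by simp
  then have "exp (1/6 :: real) \<le> 6/5"
    by (simp add: exp_minus field_simps)
  moreover have "4/3 \<le> sqrt 2"
    by (rule real_le_rsqrt) (simp add: power2_eq_square)
  then have "9/10 * (4/3) \<le> \<gamma> * sqrt 2"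
    using \<gamma> by (intro mult_mono) auto
  ultimately have base: "exp (1/6) \<le> \<gamma> * sqrt 2" by simp
  have "real l / 6 \<le> real q / real D + \<epsilon>" if \<epsilon>: "\<epsilon> > 0" for \<epsilon>
  proof -
    \<comment> \<open>This choice keeps \<open>(1 + \<epsilon>') ^ n\<close> below
      \<open>exp \<epsilon>\<close>, so the slack of the hard distributions vanishes in the
      limit.\<close>
    define \<epsilon>' where "\<epsilon>' = \<epsilon> / (real n + 1)"
    have \<epsilon>': "\<epsilon>' > 0" "real n * \<epsilon>' \<le> \<epsilon>"
      using \<epsilon> by (auto simp: \<epsilon>'_def field_simps)
    obtain \<mu> where "hard_distribution S bits X f D (1 + \<epsilon>') \<mu>"
      using hard[OF \<epsilon>'(1)] by blast
    from solves_LD_bound[OF this X l A cost]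
    have bound: "\<gamma> ^ l \<le> exp (real q / real D) * ((1 / sqrt 2) ^ l * (1 + \<epsilon>') ^ n)" .
    have "exp (real l / 6) = exp (1/6) ^ l"
      by (simp flip: exp_of_nat_mult)
    also have "\<dots> \<le> (\<gamma> * sqrt 2) ^ l"
      using base by (intro power_mono) auto
    also have "\<dots> = \<gamma> ^ l * sqrt 2 ^ l"
      by (rule power_mult_distrib)
    also have "\<dots> \<le> (exp (real q / real D) * ((1 / sqrt 2) ^ l * (1 + \<epsilon>') ^ n)) * sqrt 2 ^ l"
      using bound by (intro mult_right_mono) auto
    also have "\<dots> = exp (real q / real D) * (1 + \<epsilon>') ^ n"
      by (simp add: power_divide)
    also have "\<dots> \<le> exp (real q / real D) * exp \<epsilon>' ^ n"
      using \<epsilon>' by (intro mult_left_mono power_mono) auto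
    also have "\<dots> = exp (real q / real D + real n * \<epsilon>')"
      by (simp add: exp_add exp_of_nat_mult)
    finally have "real l / 6 \<le> real q / real D + real n * \<epsilon>'" by simp
    then show ?thesis using \<epsilon>'(2) by simp
  qed
  then have "real l / 6 \<le> real q / real D"
    by (rule field_le_epsilon)
  then show ?thesis using D by (simp add: field_simps)
qed

theorem theorem1p2:
  "\<exists>c::real. 1/2 < c \<and> c < 1 \<and>
    (\<exists>K::real. K > 0 \<and>
      (\<forall>(m::nat) (X::bool list set) (f::bool list \<Rightarrow> bool) (n::nat) (l::nat) (\<gamma>::real).
         X \<subseteq> bit_strings m \<longrightarrow> n \<ge> 1 \<longrightarrow> l \<in> {1..n} \<longrightarrow> \<gamma> \<in> {c..<1} \<longrightarrow>
         ereal_of_enat (R_comp (\<gamma> ^ l) (LD n l) n m X f)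
           \<ge> ereal (K * real l) * ereal_of_enat (R_fun m X f)))"
proof (rule exI[of _ "9/10"], intro exI[of _ "1/108"] conjI allI impI)
  fix m n l :: nat and X :: "bool list set" and f :: "bool list \<Rightarrow> bool" and \<gamma> :: real
  assume Xm: "X \<subseteq> bit_strings m" and l: "l \<in> {1..n}" and \<gamma>: "\<gamma> \<in> {9/10..<1}"
  have "bit_strings m = {xs. set xs \<subseteq> (UNIV :: bool set) \<and> length xs = m}"
    by (auto simp: bit_strings_def)
  then have "finite (bit_strings m)"
    by (simp only: finite_lists_length_eq finite)
  then have X: "finite X" using Xm by (rule rev_finite_subset)
  define r where "r = R_fun m X f"
  define Y where "Y = {xs. length xs = n \<and> set xs \<subseteq> X}"
  define \<A> where "\<A> = {A. solves ({..<n} \<times> {..<m}) (block_bits (!)) Y (\<lambda>xs. LD n l (map f xs)) (\<gamma> ^ l) A}"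
  have R: "R_comp (\<gamma> ^ l) (LD n l) n m X f = Inf (worst_cost (block_bits (!)) Y ` \<A>)"
    by (simp add: R_comp_def rand_complexity_def \<A>_def Y_def block_bits_def[abs_def])
  have r: "r = rand_complexity {..<m} (!) X (\<lambda>x. {f x}) (2/3)"
    by (simp add: r_def R_fun_def)
  have hard: "\<exists>\<mu>. hard_distribution {..<m} (!) X f D (1 + \<epsilon>) \<mu>"
    if D: "D > 0" "enat (9 * D) < r \<or> D = 1 \<and> r \<noteq> 0" and \<epsilon>: "\<epsilon> > 0" for D \<epsilon>
  proof (cases "enat (9 * D) < r")
    case True
    then show ?thesis
      using hard_distribution_exists[OF X D(1) \<epsilon>] by (simp add: r)
  next
    case False
    then have "D = 1" "r \<noteq> 0" using D by auto
    then obtain x0 x1 where x: "x0 \<in> X" "x1 \<in> X" "\<not> f x0" "f x1"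
      using rand_complexity_constant[of X f True "{..<m}" "(!)"]
        rand_complexity_constant[of X f False "{..<m}" "(!)"] r by auto
    have "hard_distribution {..<m} (!) X f D (1 + \<epsilon>) (\<lambda>x. of_bool (x = x0 \<or> x = x1) / 2)"
      using hard_distribution_nonconstant[OF X x, of "{..<m}" "(!)"] \<epsilon> \<open>D = 1\<close>
      by (fastforce simp: hard_distribution_def)
    then show ?thesis by blast
  qed
  show "ereal (1/108 * real l) * ereal_of_enat (R_fun m X f)
      \<le> ereal_of_enat (R_comp (\<gamma> ^ l) (LD n l) n m X f)"
  proof (cases "R_comp (\<gamma> ^ l) (LD n l) n m X f")
    case (enat q)
    then have "worst_cost (block_bits (!)) Y ` \<A> \<noteq> {}"
      by (auto simp: R Inf_enat_def top_enat_def)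
    \<comment> \<open>A nonempty set of extended naturals contains its infimum, so one algorithm
      attains the cost \<open>q\<close>.\<close>
    then have "enat q \<in> worst_cost (block_bits (!)) Y ` \<A>"
      using enat unfolding R Inf_enat_def by (metis (mono_tags, lifting) LeastI_ex ex_in_conv)
    then obtain A where A: "A \<in> \<A>" "worst_cost (block_bits (!)) Y A = enat q" by auto
    have cost: "cost t (block_bits (!) xs) \<le> q" if "t \<in> set_pmf A" "xs \<in> Y" for t xs
    proof -
      have "enat (cost t (block_bits (!) xs)) \<le> worst_cost (block_bits (!)) Y A"
        unfolding worst_cost_def using that by (intro SUP_upper2[of t] SUP_upper2[of xs]) auto
      then show ?thesis by (simp add: A)
    qed
    have main: "real D * real l / 6 \<le> real q"
      if "D > 0" "enat (9 * D) < r \<or> D = 1 \<and> r \<noteq> 0" for D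
      using hard[OF that] A(1) cost l \<gamma>
      by (intro solves_LD_cost[OF X _ that(1), of l n \<gamma> "{..<m}" "(!)" f A]) (auto simp: \<A>_def Y_def)
    show ?thesis
    proof (cases r)
      case (enat k)
      have "real k * real l / 108 \<le> real q"
      proof (cases "k = 0")
        case False
        \<comment> \<open>\<open>(k - 1) div 9\<close> is the largest scale with
          \<open>9 * D < k\<close>, and scale 1 serves small \<open>k\<close>. Either way
          \<open>k \<le> 18 * D\<close>, which with the factor 1/6 yields 1/108.\<close>
        define D where "D = max 1 ((k - 1) div 9)"
        have "D > 0" by (simp add: D_def)
        moreover have "enat (9 * D) < r \<or> D = 1 \<and> r \<noteq> 0"
          using False by (auto simp: enat D_def max_def zero_enat_def)
        ultimately have "real D * real l / 6 \<le> real q" by (rule main)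
        moreover have "k - 1 < 9 * ((k - 1) div 9) + 9" by presburger
        then have "k \<le> 18 * D" unfolding D_def by linarith
        then have "real k * real l \<le> (18 * real D) * real l"
          by (intro mult_right_mono) linarith+
        ultimately show ?thesis by simp
      qed simp
      then show ?thesis
        using \<open>R_comp _ _ _ _ _ _ = enat q\<close> enat by (simp add: r_def mult.commute)
    next
      case infinity
      \<comment> \<open>With \<open>r\<close> infinite every positive scale is hard, and a scale
        above \<open>6 * q\<close> contradicts the cost bound.\<close>
      define N where "N = 6 * q + 1"
      have "real N * real l / 6 \<le> real q"
        using infinity by (intro main) (auto simp: N_def)
      moreover have "real N * 1 \<le> real N * real l"
        using l by (intro mult_left_mono) auto
      ultimately have "real N \<le> 6 * real q" by linarith
      then have False by (simp add: N_def)
      then show ?thesis ..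
    qed
  qed simp
qed auto

end
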